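(* On the physical curve, for every $\ell\ge0$, as rational functions in $\mathbb Q(\varpi)(Z)$, $$F_{\ell+2}(Z)\,(Z-2\ell-4)=F_\ell(Z)\,(Z+2\ell+2)+(\varpi-2)(2\ell+3)\,F_{\ell+1}(Z).$$
   Context: Bessel polynomials: $y_n(x)=\sum_{k=0}^n\frac{(n+k)!}{(n-k)!\,k!\,2^k}x^k$. On the physical curve (parameter $\tau=e^{i\theta}$) the weights are $p=2/(1-\tau)$, $q=2/(1+\tau)$; they satisfy identically $p+q=pq=\varpi$ with $\varpi=4/(1-\tau^2)$, and $\varpi$ is treated as an indeterminate. For $\ell\ge0$ put $g_\ell(s)=y_\ell(ps)\,y_\ell(qs)=\sum_{n=0}^{2\ell}G_n^{(\ell)}s^n$ (the coefficients are symmetric in $p,q$, hence polynomials in $\varpi$), and $$F_\ell(Z)=\sum_{n=0}^{2\ell}G_n^{(\ell)}e_n(Z),\qquad e_n(Z)=\frac1{(Z-1)(Z-2)\cdots(Z-n)},\quad e_0=1.$$ *)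

theory Defs
  imports Complex_Main "HOL-Computational_Algebra.Computational_Algebra"
begin

definition bessel_poly :: "nat \<Rightarrow> 'a::field_char_0 poly" where
  "bessel_poly n = (\<Sum>k\<le>n. monom (fact (n + k) / (fact (n - k) * fact k * 2 ^ k)) k)"

text \<open>The points of the unit circle at which both weights are defined.\<close>

definition physical_curve :: "complex set" where
  "physical_curve = range cis - {1, -1}"

definition weight_p :: "complex \<Rightarrow> complex" where
  "weight_p \<tau> = 2 / (1 - \<tau>)"

definition weight_q :: "complex \<Rightarrow> complex" where
  "weight_q \<tau> = 2 / (1 + \<tau>)"

definition varpi :: "complex \<Rightarrow> complex" where
  "varpi \<tau> = 4 / (1 - \<tau>\<^sup>2)"

definition g_poly :: "nat \<Rightarrow> complex \<Rightarrow> complex poly" where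
  "g_poly l \<tau> =
     pcompose (bessel_poly l) [:0, weight_p \<tau>:] * pcompose (bessel_poly l) [:0, weight_q \<tau>:]"

text \<open>
  \<open>G_coeff l n\<close> is the polynomial in the indeterminate \<open>\<varpi>\<close> whose value at \<open>varpi \<tau>\<close> is the
  coefficient of \<open>s ^ n\<close> in \<open>g_poly l \<tau>\<close>, for every point of the physical curve. The lemma
  \<open>G_coeff_ex1\<close> below shows that there is exactly one such polynomial over the rationals.
\<close>

definition G_coeff :: "nat \<Rightarrow> nat \<Rightarrow> rat poly" where
  "G_coeff l n =
     (THE P. \<forall>\<tau>\<in>physical_curve. poly (map_poly of_rat P) (varpi \<tau>) = coeff (g_poly l \<tau>) n)"

text \<open>The field \<open>\<rat>(\<varpi>)(Z)\<close>: the inner indeterminate is \<open>\<varpi>\<close>, the outer one is \<open>Z\<close>.\<close>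

type_synonym ratfun = "rat poly fract poly fract"

definition from_base :: "rat poly \<Rightarrow> ratfun" where
  "from_base P = to_fract [:to_fract P:]"

definition varpi_ind :: ratfun where
  "varpi_ind = from_base [:0, 1:]"

definition Z_ind :: ratfun where
  "Z_ind = to_fract [:0, 1:]"

definition e_fun :: "nat \<Rightarrow> ratfun" where
  "e_fun n = 1 / (\<Prod>j=1..n. Z_ind - of_nat j)"

definition F_fun :: "nat \<Rightarrow> ratfun" where
  "F_fun l = (\<Sum>n\<le>2 * l. from_base (G_coeff l n) * e_fun n)"

lemma weights:
  assumes "\<tau> \<in> physical_curve"
  shows "weight_p \<tau> + weight_q \<tau> = varpi \<tau>" "weight_p \<tau> * weight_q \<tau> = varpi \<tau>"
proof -
  have nz: "1 - \<tau> \<noteq> 0" "1 + \<tau> \<noteq> 0"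
    using assms by (auto simp: physical_curve_def add_eq_0_iff)
  have sq: "1 - \<tau>\<^sup>2 = (1 - \<tau>) * (1 + \<tau>)"
    by (simp add: algebra_simps power2_eq_square)
  show "weight_p \<tau> + weight_q \<tau> = varpi \<tau>" "weight_p \<tau> * weight_q \<tau> = varpi \<tau>"
    unfolding weight_p_def weight_q_def varpi_def sq using nz by (simp_all add: field_simps)
qed

lemma coeff_bessel_poly:
  "coeff (bessel_poly n) k = (if k \<le> n then fact (n + k) / (fact (n - k) * fact k * 2 ^ k) else 0)"
  by (simp add: bessel_poly_def coeff_sum)

lemma coeff_bessel_poly_of_rat:
  "coeff (bessel_poly n :: complex poly) k = of_rat (coeff (bessel_poly n) k)"
proof -
  have f: "(of_rat (fact m) :: complex) = fact m" for m
    by (metis of_nat_fact of_rat_of_nat_eq)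
  show ?thesis
    by (simp add: coeff_bessel_poly of_rat_divide of_rat_mult of_rat_power f)
qed

lemma coeff_pcompose_linear:
  fixes P :: "'a::comm_semiring_1 poly"
  shows "coeff (pcompose P [:0, c:]) n = c ^ n * coeff P n"
proof (induction P arbitrary: n)
  case (pCons a P)
  then show ?case
    by (cases n) (simp_all add: pcompose_pCons mult_ac)
qed simp

lemma map_poly_of_rat_add:
  "map_poly (of_rat :: rat \<Rightarrow> complex) (P + Q) = map_poly of_rat P + map_poly of_rat Q"
  by (intro poly_eqI) (simp add: coeff_map_poly of_rat_add)

lemma map_poly_of_rat_mult:
  "map_poly (of_rat :: rat \<Rightarrow> complex) (P * Q) = map_poly of_rat P * map_poly of_rat Q"
  by (intro poly_eqI) (simp add: coeff_map_poly coeff_mult of_rat_sum of_rat_mult)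

definition poly_in_varpi :: "(complex \<Rightarrow> complex) \<Rightarrow> bool" where
  "poly_in_varpi f \<longleftrightarrow>
     (\<exists>P :: rat poly. \<forall>\<tau>\<in>physical_curve. poly (map_poly of_rat P) (varpi \<tau>) = f \<tau>)"

lemma poly_in_varpi_const: "poly_in_varpi (\<lambda>_. of_rat c)"
  unfolding poly_in_varpi_def by (rule exI[of _ "[:c:]"]) (simp add: map_poly_pCons)

lemma poly_in_varpi_varpi: "poly_in_varpi varpi"
  unfolding poly_in_varpi_def by (rule exI[of _ "[:0, 1:]"]) (simp add: map_poly_pCons)

lemma poly_in_varpi_add:
  "poly_in_varpi f \<Longrightarrow> poly_in_varpi g \<Longrightarrow> poly_in_varpi (\<lambda>\<tau>. f \<tau> + g \<tau>)"
  unfolding poly_in_varpi_def by (metis map_poly_of_rat_add poly_add)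

lemma poly_in_varpi_mult:
  "poly_in_varpi f \<Longrightarrow> poly_in_varpi g \<Longrightarrow> poly_in_varpi (\<lambda>\<tau>. f \<tau> * g \<tau>)"
  unfolding poly_in_varpi_def by (metis map_poly_of_rat_mult poly_mult)

lemma poly_in_varpi_cong:
  "poly_in_varpi f \<Longrightarrow> (\<And>\<tau>. \<tau> \<in> physical_curve \<Longrightarrow> f \<tau> = g \<tau>) \<Longrightarrow> poly_in_varpi g"
  unfolding poly_in_varpi_def by metis

lemma poly_in_varpi_sum:
  assumes "\<And>i. i \<in> A \<Longrightarrow> poly_in_varpi (f i)"
  shows "poly_in_varpi (\<lambda>\<tau>. \<Sum>i\<in>A. f i \<tau>)"
  using assms
proof (induction A rule: infinite_finite_induct)
  case (insert x A)
  then show ?case by (simp add: poly_in_varpi_add)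
qed (use poly_in_varpi_const[of 0] in simp_all)

lemma poly_in_varpi_symmetric:
  "poly_in_varpi (\<lambda>\<tau>. weight_p \<tau> ^ i * weight_q \<tau> ^ j + weight_q \<tau> ^ i * weight_p \<tau> ^ j)"
proof -
  let ?S = "\<lambda>i j \<tau>. weight_p \<tau> ^ i * weight_q \<tau> ^ j + weight_q \<tau> ^ i * weight_p \<tau> ^ j"
  have base: "poly_in_varpi (?S k 0)" for k
  proof (induction k rule: induct_nat_012)
    case 0
    show ?case using poly_in_varpi_const[of 2] by simp
  next
    case 1
    show ?case by (rule poly_in_varpi_cong[OF poly_in_varpi_varpi]) (simp add: weights)
  next
    case (ge2 k)
    have "poly_in_varpi (\<lambda>\<tau>. varpi \<tau> * (?S (Suc k) 0 \<tau> + of_rat (-1) * ?S k 0 \<tau>))"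
      by (intro poly_in_varpi_mult poly_in_varpi_add poly_in_varpi_varpi poly_in_varpi_const ge2)
    then show ?case
    proof (rule poly_in_varpi_cong)
      fix \<tau> assume t: "\<tau> \<in> physical_curve"
      have rec: "v * (p ^ Suc k + q ^ Suc k - (p ^ k + q ^ k)) = p ^ Suc (Suc k) + q ^ Suc (Suc k)"
        if a: "p + q = v" and m: "p * q = v" for p q v :: complex
      proof -
        have pp: "v * p - v = p * p"
        proof -
          have "v * p = p * p + p * q"
            by (simp add: a[symmetric] algebra_simps)
          then show ?thesis using m by simp
        qed
        have qq: "v * q - v = q * q"
        proof -
          have "v * q = q * q + p * q"
            by (simp add: a[symmetric] algebra_simps)
          then show ?thesis using m by simp
        qed
        have "v * (p ^ Suc k + q ^ Suc k - (p ^ k + q ^ k))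
            = (v * p - v) * p ^ k + (v * q - v) * q ^ k"
          by (simp add: algebra_simps)
        then show ?thesis
          by (simp add: pp qq)
      qed
      show "varpi \<tau> * (?S (Suc k) 0 \<tau> + of_rat (-1) * ?S k 0 \<tau>) = ?S (Suc (Suc k)) 0 \<tau>"
        using rec[OF weights[OF t]] by (simp add: algebra_simps)
    qed
  qed
  show ?thesis
  proof (induction j arbitrary: i)
    case 0
    show ?case by (rule base)
  next
    case (Suc j)
    show ?case
    proof (cases i)
      case 0
      show ?thesis
        by (rule poly_in_varpi_cong[OF base[of "Suc j"]]) (simp add: 0)
    next
      case (Suc i')
      show ?thesis
      proof (rule poly_in_varpi_cong[OF poly_in_varpi_mult[OF poly_in_varpi_varpi Suc.IH[of i']]])
        fix \<tau> assume t: "\<tau> \<in> physical_curve"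
        show "varpi \<tau> * ?S i' j \<tau> = ?S i (Suc j) \<tau>"
          unfolding weights(2)[OF t, symmetric] Suc by (simp add: algebra_simps)
      qed
    qed
  qed
qed

lemma poly_in_varpi_coeff_g_poly: "poly_in_varpi (\<lambda>\<tau>. coeff (g_poly l \<tau>) n)"
proof -
  let ?a = "\<lambda>i. coeff (bessel_poly l :: rat poly) i"
  let ?S = "\<lambda>i j \<tau>. weight_p \<tau> ^ i * weight_q \<tau> ^ j + weight_q \<tau> ^ i * weight_p \<tau> ^ j"
  have "poly_in_varpi (\<lambda>\<tau>. of_rat (1/2) * (\<Sum>i\<le>n. of_rat (?a i * ?a (n - i)) * ?S i (n - i) \<tau>))"
    by (intro poly_in_varpi_mult poly_in_varpi_const poly_in_varpi_sum poly_in_varpi_symmetric)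
  then show ?thesis
  proof (rule poly_in_varpi_cong)
    fix \<tau>
    let ?t = "\<lambda>x y. \<Sum>i\<le>n. (of_rat (?a i * ?a (n - i)) :: complex) * (x ^ i * y ^ (n - i))"
    have c: "coeff (g_poly l \<tau>) n = ?t (weight_p \<tau>) (weight_q \<tau>)"
      unfolding g_poly_def coeff_mult coeff_pcompose_linear coeff_bessel_poly_of_rat
      by (intro sum.cong) (simp_all add: of_rat_mult mult_ac)
    have sym: "?t (weight_q \<tau>) (weight_p \<tau>) = ?t (weight_p \<tau>) (weight_q \<tau>)"
      by (rule sum.reindex_bij_witness[of _ "\<lambda>i. n - i" "\<lambda>i. n - i"]) (auto simp: mult_ac)
    have "(\<Sum>i\<le>n. of_rat (?a i * ?a (n - i)) * ?S i (n - i) \<tau>)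
        = ?t (weight_p \<tau>) (weight_q \<tau>) + ?t (weight_q \<tau>) (weight_p \<tau>)"
      by (simp add: distrib_left sum.distrib)
    then show "of_rat (1/2) * (\<Sum>i\<le>n. of_rat (?a i * ?a (n - i)) * ?S i (n - i) \<tau>)
        = coeff (g_poly l \<tau>) n"
      unfolding c sym by (simp add: of_rat_divide)
  qed
qed

lemma infinite_varpi_physical_curve: "infinite (varpi ` physical_curve)"
proof
  assume fin: "finite (varpi ` physical_curve)"
  have "inj_on (\<lambda>\<theta>. varpi (cis \<theta>)) {0<..<pi/2}"
  proof (rule inj_onI)
    fix a b assume ab: "a \<in> {0<..<pi/2}" "b \<in> {0<..<pi/2}" and eq: "varpi (cis a) = varpi (cis b)"
    have ne: "1 - cis (2 * x) \<noteq> 0" if "x \<in> {0<..<pi/2}" for x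
    proof
      assume "1 - cis (2 * x) = 0"
      then have "sin (2 * x) = 0" by (auto simp: complex_eq_iff)
      moreover have "sin (2 * x) > 0" using that by (intro sin_gt_zero) auto
      ultimately show False by simp
    qed
    have "cis (2 * a) = cis (2 * b)"
      using eq ne[OF ab(1)] ne[OF ab(2)] by (simp add: varpi_def DeMoivre field_simps)
    then have "cos (2 * a) = cos (2 * b)" by (auto simp: complex_eq_iff)
    then show "a = b" using cos_inj_pi[of "2 * a" "2 * b"] ab by auto
  qed
  moreover have "infinite {0<..<pi/2}" by (simp add: infinite_Ioo)
  ultimately have "infinite ((\<lambda>\<theta>. varpi (cis \<theta>)) ` {0<..<pi/2})"
    using finite_imageD by blast
  moreover have "(\<lambda>\<theta>. varpi (cis \<theta>)) ` {0<..<pi/2} \<subseteq> varpi ` physical_curve"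
  proof (rule image_subsetI)
    fix x assume "x \<in> {0<..<pi/2}"
    then have "sin x > 0" by (intro sin_gt_zero) auto
    then have "cis x \<noteq> 1" "cis x \<noteq> -1" by (auto simp: complex_eq_iff)
    then show "varpi (cis x) \<in> varpi ` physical_curve" by (auto simp: physical_curve_def)
  qed
  ultimately show False using fin finite_subset by blast
qed

lemma G_coeff_ex1:
  "\<exists>!P :: rat poly. \<forall>\<tau>\<in>physical_curve.
     poly (map_poly of_rat P) (varpi \<tau>) = coeff (g_poly l \<tau>) n"
proof (rule ex_ex1I)
  show "\<exists>P :: rat poly. \<forall>\<tau>\<in>physical_curve.
     poly (map_poly of_rat P) (varpi \<tau>) = coeff (g_poly l \<tau>) n"
    using poly_in_varpi_coeff_g_poly by (simp add: poly_in_varpi_def)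
next
  fix P Q :: "rat poly"
  assume P: "\<forall>\<tau>\<in>physical_curve. poly (map_poly of_rat P) (varpi \<tau>) = coeff (g_poly l \<tau>) n"
    and Q: "\<forall>\<tau>\<in>physical_curve. poly (map_poly of_rat Q) (varpi \<tau>) = coeff (g_poly l \<tau>) n"
  let ?D = "map_poly of_rat P - map_poly of_rat Q :: complex poly"
  have "varpi ` physical_curve \<subseteq> {x. poly ?D x = 0}"
    using P Q by auto
  then have "infinite {x. poly ?D x = 0}"
    using infinite_varpi_physical_curve finite_subset by blast
  then have "?D = 0" using poly_roots_finite by blast
  then have "coeff (map_poly of_rat P :: complex poly) i = coeff (map_poly of_rat Q) i" for i
    by simp
  then show "P = Q" by (intro poly_eqI) (simp add: coeff_map_poly)
qed

lemma poly_G_coeff: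
  "\<tau> \<in> physical_curve \<Longrightarrow>
     poly (map_poly of_rat (G_coeff l n)) (varpi \<tau>) = coeff (g_poly l \<tau>) n"
  using theI'[OF G_coeff_ex1[of l n]] unfolding G_coeff_def by blast

end

theory Submission
  imports Defs
begin

text \<open>
  The functions \<open>e\<^sub>n\<close> satisfy \<open>(Z - n) e\<^sub>n = e\<^bsub>n-1\<^esub>\<close>, so under the linear map \<open>s\<^sup>n \<mapsto> e\<^sub>n\<close>, which
  sends \<open>g\<^sub>l\<close> to \<open>F\<^sub>l\<close>, multiplication by \<open>Z\<close> corresponds to the operator \<open>h \<mapsto> h / s + s h'\<close> on
  polynomials \<open>h\<close> without constant term. (Analytically, \<open>e\<^sub>n = \<Gamma>(Z - n) / \<Gamma>(Z)\<close>, the map is a Mellin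
  transform, and this is integration by parts.) The difference \<open>H = g\<^bsub>l+2\<^esub> - g\<^sub>l\<close> has no constant
  term, because \<open>y\<^sub>n(0) = 1\<close> for all \<open>n\<close>. Collecting the terms with a factor \<open>Z\<close> into
  \<open>Z (F\<^bsub>l+2\<^esub> - F\<^sub>l)\<close> therefore reduces the claim to the polynomial identity
  \<open>H + s\<^sup>2 H' = s ((2l + 4) g\<^bsub>l+2\<^esub> + (2l + 2) g\<^sub>l + (\<varpi> - 2)(2l + 3) g\<^bsub>l+1\<^esub>)\<close>
  (\<open>bessel_prod_differential_relation\<close>).

  That identity follows from two differential relations of the Bessel polynomials,
  \<open>x\<^sup>2 y\<^sub>n' = y\<^bsub>n+1\<^esub> - (1 + (n + 1) x) y\<^sub>n\<close> and
  \<open>x\<^sup>2 y\<^bsub>n+1\<^esub>' = ((n + 1) x - 1) y\<^bsub>n+1\<^esub> + y\<^sub>n\<close>, and from the three-term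
  recurrence \<open>y\<^bsub>n+2\<^esub> = (2n + 3) x y\<^bsub>n+1\<^esub> + y\<^sub>n\<close> that they imply. By the chain rule, rescaling
  \<open>x\<close> to \<open>p s\<close> and \<open>q s\<close> divides the terms of \<open>s\<^sup>2 H'\<close> by \<open>p\<close> or \<open>q\<close>. The hypothesis \<open>p + q = p q = \<varpi>\<close> enters twice: \<open>1/p + 1/q = 1\<close> makes the
  constant terms of the factors \<open>(l + 2) x - 1\<close> and \<open>1 + (l + 1) x\<close> contribute exactly \<open>-H\<close> to
  \<open>s\<^sup>2 H'\<close>, which cancels \<open>H\<close>, and \<open>p/q + q/p = \<varpi> - 2\<close> is the coefficient left
  in front of \<open>g\<^bsub>l+1\<^esub>\<close>.

  The identity is applied at each point of the physical curve. It transfers to the coefficients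
  in \<open>\<rat>[\<varpi>]\<close> because \<open>\<varpi>\<close> takes infinitely many values there
  (\<open>rat_poly_eqI_physical_curve\<close>).
\<close>

section \<open>Differential relations of the Bessel polynomials\<close>

text \<open>
  Away from the truncation both coefficients on the left are explicit multiples of
  \<open>coeff (bessel_poly n) k\<close>, namely by \<open>(n + k + 1)(n + k + 2) / (2 (k + 1))\<close> and
  \<open>(n + k + 1)(n - k) / (2 (k + 1))\<close>.
\<close>

lemma coeff_bessel_poly_diff:
  "coeff (bessel_poly (Suc n) :: 'a::field_char_0 poly) (Suc k) - coeff (bessel_poly n) (Suc k)
     = of_nat (Suc (n + k)) * coeff (bessel_poly n) k"
proof -
  have nz: "(1 + of_nat m :: 'a) \<noteq> 0" "(2 + of_nat m :: 'a) \<noteq> 0"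
    "(2 + of_nat m * 2 :: 'a) \<noteq> 0" for m
    using of_nat_neq_0[of m, where ?'a='a] of_nat_neq_0[of "Suc m", where ?'a='a]
      of_nat_neq_0[of "2 * m + 1", where ?'a='a]
    by (auto simp: algebra_simps)
  \<comment> \<open>Only for \<open>k < n\<close> are all three coefficients given by the factorial formula; for \<open>k = n\<close> the
    middle one is zero by truncation.\<close>
  consider d where "n = Suc (k + d)" | "k = n" | "k > n"
    by (metis less_imp_Suc_add linorder_neqE_nat)
  then show ?thesis
  proof cases
    case 1
    show ?thesis unfolding 1 using nz[of k] nz[of d]
      by (simp add: coeff_bessel_poly divide_simps, simp add: algebra_simps)
  next
    case 2
    show ?thesis unfolding 2 using nz[of n]
      by (simp add: coeff_bessel_poly divide_simps)
  qed (simp add: coeff_bessel_poly)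
qed

text \<open>
  This turns the right-hand side of the previous lemma into a multiple of a coefficient of
  \<open>bessel_poly (Suc n)\<close>, so that one coefficient difference yields both the raising and the lowering
  relation.
\<close>

lemma coeff_bessel_poly_Suc:
  assumes "k \<le> Suc n"
  shows "of_nat (Suc n - k) * coeff (bessel_poly (Suc n) :: 'a::field_char_0 poly) k
     = of_nat (Suc (n + k)) * coeff (bessel_poly n) k"
proof (cases "k \<le> n")
  case True
  then obtain d where n: "n = k + d" using le_Suc_ex by blast
  have nz: "(1 + of_nat m :: 'a) \<noteq> 0" for m
    using of_nat_neq_0[of "m", where ?'a='a] by (auto simp: algebra_simps)
  show ?thesis unfolding n using nz[of d]
    by (simp add: coeff_bessel_poly divide_simps)
qed (use assms in \<open>simp add: coeff_bessel_poly\<close>)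

lemma coeff_bessel_poly_0 [simp]: "coeff (bessel_poly n) 0 = 1"
  by (simp add: coeff_bessel_poly del: fact_Suc)

lemma bessel_poly_raise:
  "[:0, 0, 1:] * pderiv (bessel_poly n) =
     bessel_poly (Suc n) - [:1, of_nat (Suc n):] * (bessel_poly n :: 'a::field_char_0 poly)"
proof (rule poly_eqI)
  fix k
  show "coeff ([:0, 0, 1:] * pderiv (bessel_poly n)) k = coeff (bessel_poly (Suc n)
          - [:1, of_nat (Suc n):] * (bessel_poly n :: 'a poly)) k"
  proof (cases k)
    case 0
    then show ?thesis by simp
  next
    case (Suc m)
    show ?thesis unfolding Suc using coeff_bessel_poly_diff[of n m, where ?'a='a]
      by (cases m) (simp_all add: coeff_pderiv algebra_simps)
  qed
qed

lemma bessel_poly_lower: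
  "[:0, 0, 1:] * pderiv (bessel_poly (Suc n)) =
     [:-1, of_nat (Suc n):] * bessel_poly (Suc n) + (bessel_poly n :: 'a::field_char_0 poly)"
proof (rule poly_eqI)
  fix k
  show "coeff ([:0, 0, 1:] * pderiv (bessel_poly (Suc n))) k =
     coeff ([:-1, of_nat (Suc n):] * bessel_poly (Suc n) + (bessel_poly n :: 'a poly)) k"
  proof (cases k)
    case 0
    then show ?thesis by simp
  next
    case (Suc m)
    have s: "(of_nat (Suc n) - of_nat m) * coeff (bessel_poly (Suc n) :: 'a poly) m
       = of_nat (Suc (n + m)) * coeff (bessel_poly n) m"
    proof (cases "m \<le> Suc n")
      case True
      then show ?thesis using coeff_bessel_poly_Suc[OF True, where ?'a='a]
        by (simp only: of_nat_diff)
    qed (simp add: coeff_bessel_poly)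
    show ?thesis unfolding Suc using coeff_bessel_poly_diff[of n m, where ?'a='a] s
      by (cases m) (simp_all add: coeff_pderiv algebra_simps)
  qed
qed

text \<open>
  Raising from \<open>Suc n\<close> and lowering to \<open>n\<close> compute the same derivative; equating the two leaves the
  three-term recurrence.
\<close>

lemma bessel_poly_rec:
  "bessel_poly (Suc (Suc n)) =
     [:0, of_nat (2 * n + 3):] * bessel_poly (Suc n) + (bessel_poly n :: 'a::field_char_0 poly)"
proof -
  have "[:1, of_nat (Suc (Suc n)):] + [:-1, of_nat (Suc n):] = [:0, of_nat (2 * n + 3) :: 'a:]"
    by (simp add: algebra_simps)
  moreover have "bessel_poly (Suc (Suc n)) =
      ([:1, of_nat (Suc (Suc n)):] + [:-1, of_nat (Suc n):]) * bessel_poly (Suc n)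
      + (bessel_poly n :: 'a poly)"
    using bessel_poly_raise[of "Suc n", where ?'a='a] bessel_poly_lower[of n, where ?'a='a]
    by (simp only: distrib_right) algebra
  ultimately show ?thesis by (simp only:)
qed

section \<open>Products of two rescaled Bessel polynomials\<close>

definition scaled_bessel :: "nat \<Rightarrow> 'a::field_char_0 \<Rightarrow> 'a poly" where
  "scaled_bessel n c = pcompose (bessel_poly n) [:0, c:]"

definition bessel_prod :: "nat \<Rightarrow> 'a::field_char_0 \<Rightarrow> 'a \<Rightarrow> 'a poly" where
  "bessel_prod n p q = scaled_bessel n p * scaled_bessel n q"

lemma poly_scaled_bessel_raise:
  fixes p s :: "'a::field_char_0"
  shows "p * (s\<^sup>2 * poly (pderiv (scaled_bessel n p)) s) =
     poly (scaled_bessel (Suc n) p) s - (1 + of_nat (Suc n) * (p * s)) * poly (scaled_bessel n p) s"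
  using arg_cong[OF bessel_poly_raise[of n, where ?'a='a], of "\<lambda>f. poly f (p * s)"]
  by (simp add: scaled_bessel_def pderiv_pcompose poly_pcompose pderiv_pCons power2_eq_square
      algebra_simps)

lemma poly_scaled_bessel_lower:
  fixes p s :: "'a::field_char_0"
  shows "p * (s\<^sup>2 * poly (pderiv (scaled_bessel (Suc n) p)) s) =
     (of_nat (Suc n) * (p * s) - 1) * poly (scaled_bessel (Suc n) p) s + poly (scaled_bessel n p) s"
  using arg_cong[OF bessel_poly_lower[of n, where ?'a='a], of "\<lambda>f. poly f (p * s)"]
  by (simp add: scaled_bessel_def pderiv_pcompose poly_pcompose pderiv_pCons power2_eq_square
      algebra_simps)

lemma poly_scaled_bessel_rec:
  fixes p s :: "'a::field_char_0"
  shows "poly (scaled_bessel (Suc (Suc n)) p) s =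
     of_nat (2 * n + 3) * (p * s) * poly (scaled_bessel (Suc n) p) s + poly (scaled_bessel n p) s"
  using arg_cong[OF bessel_poly_rec[of n, where ?'a='a], of "\<lambda>f. poly f (p * s)"]
  by (simp add: scaled_bessel_def poly_pcompose algebra_simps)

text \<open>
  In the application \<open>a\<close>, \<open>b\<close>, \<open>c\<close> are the values of \<open>y\<^sub>l\<close>, \<open>y\<^bsub>l+1\<^esub>\<close>, \<open>y\<^bsub>l+2\<^esub>\<close> at \<open>p s\<close>, the
  capital letters those at \<open>q s\<close>, primes are derivatives in \<open>s\<close>, and \<open>n = l\<close>. Using the lowering relation for
  index \<open>l + 2\<close> and the raising one for \<open>l\<close> writes each derivative in terms of
  the function itself and \<open>b\<close> or \<open>B\<close>, so that the mixed terms pair up as \<open>B (c - a)\<close> and \<open>b (C - A)\<close>; by the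
  recurrence these are multiples of \<open>b B\<close>.
\<close>

lemma bessel_prod_relation_pointwise:
  fixes a b c A B C a' c' A' C' p q s n :: "'a::field_char_0"
  assumes pq: "p + q = p * q" and nz: "p * q \<noteq> 0"
    and c: "c = (2 * n + 3) * (p * s) * b + a" and C: "C = (2 * n + 3) * (q * s) * B + A"
    and c': "p * (s\<^sup>2 * c') = ((n + 2) * (p * s) - 1) * c + b"
    and C': "q * (s\<^sup>2 * C') = ((n + 2) * (q * s) - 1) * C + B"
    and a': "p * (s\<^sup>2 * a') = b - (1 + (n + 1) * (p * s)) * a"
    and A': "q * (s\<^sup>2 * A') = B - (1 + (n + 1) * (q * s)) * A"
  shows "c * C - a * A + s\<^sup>2 * (c * C' + C * c' - (a * A' + A * a')) =
     s * ((2 * n + 4) * (c * C) + (2 * n + 2) * (a * A) + (p * q - 2) * (2 * n + 3) * (b * B))"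
proof -
  \<comment> \<open>The factor \<open>p * q\<close> clears the denominators that the chain rule produces.\<close>
  have "p * q * (s\<^sup>2 * (c * C' + C * c' - (a * A' + A * a'))) =
      p * c * (q * (s\<^sup>2 * C')) + q * C * (p * (s\<^sup>2 * c'))
      - p * a * (q * (s\<^sup>2 * A')) - q * A * (p * (s\<^sup>2 * a'))"
    by (simp add: algebra_simps)
  also have "\<dots> = p * q * (s * ((2 * n + 4) * (c * C) + (2 * n + 2) * (a * A)))
      + (p + q) * (a * A - c * C) + (p * B * (c - a) + q * b * (C - A))"
    unfolding c' C' a' A' by (simp add: algebra_simps)
  also have "p * B * (c - a) + q * b * (C - A) = (p\<^sup>2 + q\<^sup>2) * ((2 * n + 3) * s * (b * B))"
    unfolding c C by (simp add: algebra_simps power2_eq_square)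
  also have "p\<^sup>2 + q\<^sup>2 = p * q * (p * q - 2)"
  proof -
    have "p\<^sup>2 + q\<^sup>2 = (p + q)\<^sup>2 - 2 * (p * q)"
      by (simp add: power2_eq_square algebra_simps)
    then show ?thesis unfolding pq by (simp add: power2_eq_square algebra_simps)
  qed
  finally have "p * q * (s\<^sup>2 * (c * C' + C * c' - (a * A' + A * a'))) =
     p * q * (s * ((2 * n + 4) * (c * C) + (2 * n + 2) * (a * A))
       + (a * A - c * C) + (p * q - 2) * ((2 * n + 3) * s * (b * B)))"
    unfolding pq by (simp add: algebra_simps)
  then have "s\<^sup>2 * (c * C' + C * c' - (a * A' + A * a')) =
     s * ((2 * n + 4) * (c * C) + (2 * n + 2) * (a * A))
       + (a * A - c * C) + (p * q - 2) * ((2 * n + 3) * s * (b * B))"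
    using nz by simp
  then show ?thesis by (simp add: algebra_simps)
qed

text \<open>
  Two polynomials over an infinite field agree once their values do, and for values the relation is a
  ring identity.
\<close>

lemma bessel_prod_differential_relation:
  fixes p q w :: "'a::field_char_0"
  assumes pq: "p + q = w" "p * q = w" and nz: "w \<noteq> 0"
  shows "bessel_prod (Suc (Suc l)) p q - bessel_prod l p q
       + [:0, 0, 1:] * pderiv (bessel_prod (Suc (Suc l)) p q - bessel_prod l p q) =
     [:0, 1:] * (smult (of_nat (2 * l + 4)) (bessel_prod (Suc (Suc l)) p q)
        + smult (of_nat (2 * l + 2)) (bessel_prod l p q)
        + smult ((w - 2) * of_nat (2 * l + 3)) (bessel_prod (Suc l) p q))"
    (is "?L = ?R")
proof -
  have "poly ?L s = poly ?R s" for s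
  proof -
    define n :: 'a where "n = of_nat l"
    have n: "of_nat (2 * l + 3) = 2 * n + 3" "of_nat (2 * l + 4) = 2 * n + 4"
      "of_nat (2 * l + 2) = 2 * n + 2" "of_nat (Suc l) = n + 1" "of_nat (Suc (Suc l)) = n + 2"
      by (simp_all add: n_def)
    have "p + q = p * q" "p * q \<noteq> 0" using pq nz by auto
    from bessel_prod_relation_pointwise[OF this
        poly_scaled_bessel_rec[of l p s, unfolded n] poly_scaled_bessel_rec[of l q s, unfolded n]
        poly_scaled_bessel_lower[of p s "Suc l", unfolded n]
        poly_scaled_bessel_lower[of q s "Suc l", unfolded n]
        poly_scaled_bessel_raise[of p s l, unfolded n]
        poly_scaled_bessel_raise[of q s l, unfolded n]]
    show ?thesis unfolding n pq(2)
      by (simp add: bessel_prod_def pderiv_diff pderiv_mult power2_eq_square algebra_simps)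
  qed
  then show ?thesis by (simp only: poly_eq_poly_eq_iff[symmetric] fun_eq_iff) simp
qed

text \<open>
  The comparison is made at \<open>s\<^bsup>m+1\<^esup>\<close>: dividing the relation by \<open>s\<close> turns its left-hand side into
  \<open>H / s + s H'\<close>, the operator that corresponds to multiplication by \<open>Z\<close>.
\<close>

lemma coeff_bessel_prod_relation:
  fixes p q w :: "'a::field_char_0" and l :: nat
  assumes "p + q = w" "p * q = w" "w \<noteq> 0"
  defines "H \<equiv> \<lambda>m. coeff (bessel_prod (Suc (Suc l)) p q) m - coeff (bessel_prod l p q) m"
  shows "H (Suc m) + of_nat m * H m =
     of_nat (2 * l + 4) * coeff (bessel_prod (Suc (Suc l)) p q) m
     + of_nat (2 * l + 2) * coeff (bessel_prod l p q) m
     + (w - 2) * of_nat (2 * l + 3) * coeff (bessel_prod (Suc l) p q) m"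
  using arg_cong[OF bessel_prod_differential_relation[OF assms(1-3), of l],
      of "\<lambda>f. coeff f (Suc m)"]
  by (cases m) (simp_all add: H_def coeff_pderiv algebra_simps)

section \<open>From the physical curve to the indeterminate\<close>

lemma g_poly_eq_bessel_prod: "g_poly l \<tau> = bessel_prod l (weight_p \<tau>) (weight_q \<tau>)"
  by (simp add: g_poly_def bessel_prod_def scaled_bessel_def)

lemma varpi_nonzero:
  assumes "\<tau> \<in> physical_curve"
  shows "varpi \<tau> \<noteq> 0"
  using assms by (auto simp: physical_curve_def varpi_def power2_eq_1_iff)

text \<open>
  The difference of the two sides has infinitely many roots, as \<open>varpi\<close> takes infinitely many values
  on the curve.
\<close>

lemma rat_poly_eqI_physical_curve:
  fixes P Q :: "rat poly"
  assumes "\<And>\<tau>. \<tau> \<in> physical_curve \<Longrightarrow>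
      poly (map_poly of_rat P) (varpi \<tau>) = poly (map_poly of_rat Q) (varpi \<tau>)"
  shows "P = Q"
proof -
  let ?D = "map_poly of_rat P - map_poly of_rat Q :: complex poly"
  have "varpi ` physical_curve \<subseteq> {x. poly ?D x = 0}"
    using assms by auto
  then have "?D = 0"
    using infinite_varpi_physical_curve finite_subset poly_roots_finite by metis
  then have "coeff (map_poly of_rat P :: complex poly) i = coeff (map_poly of_rat Q) i" for i
    by simp
  then show ?thesis
    by (intro poly_eqI) (simp add: coeff_map_poly)
qed

lemma map_poly_of_rat_of_nat [simp]: "map_poly of_rat (of_nat n) = (of_nat n :: complex poly)"
  by (simp add: of_nat_poly map_poly_pCons)

lemma map_poly_of_rat_diff:
  "map_poly (of_rat :: rat \<Rightarrow> complex) (P - Q) = map_poly of_rat P - map_poly of_rat Q"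
  by (intro poly_eqI) (simp add: coeff_map_poly of_rat_diff)

lemma G_coeff_relation:
  "(G_coeff (Suc (Suc l)) (Suc m) - G_coeff l (Suc m))
     + of_nat m * (G_coeff (Suc (Suc l)) m - G_coeff l m) =
     of_nat (2 * l + 4) * G_coeff (Suc (Suc l)) m + of_nat (2 * l + 2) * G_coeff l m
     + ([:0, 1:] - of_nat 2) * of_nat (2 * l + 3) * G_coeff (Suc l) m"
proof (rule rat_poly_eqI_physical_curve)
  fix \<tau> assume t: "\<tau> \<in> physical_curve"
  have X: "map_poly of_rat [:0, 1:] = ([:0, 1:] :: complex poly)"
    by (simp add: map_poly_pCons)
  show "poly (map_poly of_rat ((G_coeff (Suc (Suc l)) (Suc m) - G_coeff l (Suc m))
      + of_nat m * (G_coeff (Suc (Suc l)) m - G_coeff l m))) (varpi \<tau>) =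
    poly (map_poly of_rat (of_nat (2 * l + 4) * G_coeff (Suc (Suc l)) m
      + of_nat (2 * l + 2) * G_coeff l m
      + ([:0, 1:] - of_nat 2) * of_nat (2 * l + 3) * G_coeff (Suc l) m)) (varpi \<tau>)"
    using coeff_bessel_prod_relation[OF weights[OF t] varpi_nonzero[OF t], of l m]
    by (simp only: map_poly_of_rat_add map_poly_of_rat_mult map_poly_of_rat_diff
        map_poly_of_rat_of_nat X poly_add poly_mult poly_diff poly_G_coeff[OF t]
        g_poly_eq_bessel_prod poly_of_nat) simp
qed

lemma G_coeff_0: "G_coeff l 0 = 1"
proof (rule rat_poly_eqI_physical_curve)
  fix \<tau> assume t: "\<tau> \<in> physical_curve"
  show "poly (map_poly of_rat (G_coeff l 0)) (varpi \<tau>) = poly (map_poly of_rat 1) (varpi \<tau>)"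
    unfolding poly_G_coeff[OF t]
    by (simp add: g_poly_def coeff_mult coeff_pcompose_linear poly_0_coeff_0 one_pCons
        map_poly_pCons)
qed

lemma degree_bessel_poly_le: "degree (bessel_poly n) \<le> n"
  by (rule degree_le) (simp add: coeff_bessel_poly)

lemma G_coeff_eq_0:
  assumes "m > 2 * l"
  shows "G_coeff l m = 0"
proof (rule rat_poly_eqI_physical_curve)
  fix \<tau> assume t: "\<tau> \<in> physical_curve"
  have "degree (g_poly l \<tau>) \<le> l * 1 + l * 1"
    unfolding g_poly_def
    by (intro order_trans[OF degree_mult_le] add_mono order_trans[OF degree_pcompose_le]
        mult_mono degree_bessel_poly_le) (simp_all add: degree_pCons_le)
  then have "coeff (g_poly l \<tau>) m = 0"
    using assms by (intro coeff_eq_0) simp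
  then show "poly (map_poly of_rat (G_coeff l m)) (varpi \<tau>) = poly (map_poly of_rat 0) (varpi \<tau>)"
    unfolding poly_G_coeff[OF t] by simp
qed

section \<open>Inverse factorial sums\<close>

lemma from_base_simps:
  "from_base (P + Q) = from_base P + from_base Q"
  "from_base (P - Q) = from_base P - from_base Q"
  "from_base (P * Q) = from_base P * from_base Q"
  "from_base 0 = 0" "from_base 1 = 1"
  by (simp_all add: from_base_def flip: to_fract_add to_fract_diff to_fract_mult one_pCons)

lemma from_base_of_nat: "from_base (of_nat n) = of_nat n"
  by (induction n) (simp_all add: from_base_simps)

lemma to_fract_of_nat: "to_fract (of_nat n) = of_nat n"
  by (induction n) simp_all

lemma Z_ind_neq_of_nat: "Z_ind - of_nat j \<noteq> 0"
proof
  assume "Z_ind - of_nat j = 0"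
  then have "to_fract [:0, 1:] = (to_fract (of_nat j) :: ratfun)"
    by (simp add: Z_ind_def to_fract_of_nat)
  then show False by (simp add: of_nat_poly)
qed

lemma Z_mult_e_fun_Suc: "Z_ind * e_fun (Suc n) = e_fun n + of_nat (Suc n) * e_fun (Suc n)"
proof -
  have "(Z_ind - of_nat (Suc n)) * e_fun (Suc n) = e_fun n"
    using Z_ind_neq_of_nat[of "Suc n"] by (simp add: e_fun_def)
  then show ?thesis by (simp add: algebra_simps)
qed

text \<open>
  Each term \<open>c n * e_fun n\<close> contributes \<open>of_nat n * c n\<close> at \<open>n\<close> and, shifted down, \<open>c n\<close> at \<open>n - 1\<close>.
  There is no \<open>e_fun (-1)\<close> to shift into, whence \<open>c 0 = 0\<close>; \<open>c (Suc N) = 0\<close> lets both sums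
  have the same range.
\<close>

lemma Z_mult_inverse_factorial_sum:
  fixes c :: "nat \<Rightarrow> ratfun"
  assumes "c 0 = 0" "c (Suc N) = 0"
  shows "Z_ind * (\<Sum>n\<le>N. c n * e_fun n) = (\<Sum>n\<le>N. (c (Suc n) + of_nat n * c n) * e_fun n)"
proof -
  have "Z_ind * (\<Sum>n\<le>N. c n * e_fun n) =
      (\<Sum>n\<le>N. (c (Suc n) + of_nat n * c n) * e_fun n) - c (Suc N) * e_fun N"
    \<comment> \<open>For a sum cut off at an arbitrary \<open>N\<close> the boundary term is needed.\<close>
    using assms(1)
  proof (induction N)
    case (Suc N)
    then show ?case
      by (simp add: distrib_left mult.left_commute[of Z_ind] Z_mult_e_fun_Suc)
        (simp add: algebra_simps)
  qed simp
  then show ?thesis using assms(2) by simp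
qed

text \<open>A common range allows the three sums in the recurrence to be compared term by term.\<close>

lemma F_fun_eq_sum:
  assumes "2 * l \<le> N"
  shows "F_fun l = (\<Sum>n\<le>N. from_base (G_coeff l n) * e_fun n)"
  unfolding F_fun_def using assms
  by (intro sum.mono_neutral_left) (auto simp: G_coeff_eq_0 from_base_simps)

theorem theorem5p2:
  fixes l :: nat
  shows "F_fun (l + 2) * (Z_ind - of_nat (2 * l + 4)) =
           F_fun l * (Z_ind + of_nat (2 * l + 2)) +
           (varpi_ind - 2) * of_nat (2 * l + 3) * F_fun (l + 1)"
proof -
  define N where "N = 2 * l + 4"
  let ?G = "\<lambda>i n. from_base (G_coeff i n)"
  have F: "F_fun i = (\<Sum>n\<le>N. ?G i n * e_fun n)" if "i \<le> Suc (Suc l)" for i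
    using that by (intro F_fun_eq_sum) (simp add: N_def)
  have "Z_ind * (F_fun (Suc (Suc l)) - F_fun l) =
      Z_ind * (\<Sum>n\<le>N. (?G (Suc (Suc l)) n - ?G l n) * e_fun n)"
    by (simp add: F sum_subtractf left_diff_distrib)
  also have "\<dots> = (\<Sum>n\<le>N. ((?G (Suc (Suc l)) (Suc n) - ?G l (Suc n))
      + of_nat n * (?G (Suc (Suc l)) n - ?G l n)) * e_fun n)"
    by (rule Z_mult_inverse_factorial_sum) (simp_all add: G_coeff_0 G_coeff_eq_0 N_def)
  also have "\<dots> = (\<Sum>n\<le>N. (of_nat (2 * l + 4) * ?G (Suc (Suc l)) n + of_nat (2 * l + 2) * ?G l n
      + (varpi_ind - of_nat 2) * of_nat (2 * l + 3) * ?G (Suc l) n) * e_fun n)"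
    using arg_cong[OF G_coeff_relation[of l], of from_base]
    by (simp only: from_base_simps from_base_of_nat varpi_ind_def)
  also have "\<dots> = of_nat (2 * l + 4) * F_fun (Suc (Suc l)) + of_nat (2 * l + 2) * F_fun l
      + (varpi_ind - of_nat 2) * of_nat (2 * l + 3) * F_fun (Suc l)"
    by (simp only: F le_refl le_SucI sum.distrib sum_distrib_left distrib_right mult.assoc)
  finally show ?thesis by (simp add: algebra_simps)
qed

end
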